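(* Let $r\ge 1$ and fix a standard representation $[I_r|D]$ of $P_r$ over $GF(2)$ with respect to a basis $B$ of $P_r$. For every cocircuit $C^*$ of $P_r$, the switching operation $\sigma_{C^*}$ on $\mathcal{M}_r$ can be expressed as a composition of switchings with respect to row-cocircuits of $P_r$.
   Context: $P_r=PG(r-1,2)$ is the rank-$r$ binary projective geometry, i.e. the simple binary matroid on the nonzero vectors of $GF(2)^r$. $\mathcal{M}_r$ is the set of all restrictions of the fixed matroid $P_r$ (to arbitrary subsets of $E(P_r)$). For a cocircuit $C^*$ of $P_r$ and $M\in\mathcal{M}_r$, the switching $\sigma_{C^*}(M)$ is the restriction of $P_r$ to the symmetric difference $E(M)\bigtriangleup C^*$. Given the standard representation $[I_r|D]$ of $P_r$ with respect to the basis $B$ (the columns of $I_r$ being labelled by $B$), row $i$ of this matrix is the incidence vector of a cocircuit of $P_r$ (a fundamental cocircuit with respect to the cobasis $E(P_r)-B$); such a cocircuit is called a row-cocircuit. *)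

theory Defs
  imports "HOL-Analysis.Analysis" "HOL-Library.Z2"
begin

record 'e matroid =
  ground :: "'e set"
  indeps :: "'e set set"

(* The record itself does not enforce the axioms; vector_matroid_is_matroid below
   establishes them for vector matroids. *)
definition is_matroid :: "'e matroid \<Rightarrow> bool" where
  "is_matroid M \<longleftrightarrow>
     finite (ground M) \<and>
     (\<forall>I\<in>indeps M. I \<subseteq> ground M) \<and>
     {} \<in> indeps M \<and>
     (\<forall>I\<in>indeps M. \<forall>J. J \<subseteq> I \<longrightarrow> J \<in> indeps M) \<and>
     (\<forall>I\<in>indeps M. \<forall>J\<in>indeps M. card I < card J \<longrightarrow> (\<exists>x\<in>J - I. insert x I \<in> indeps M))"

definition basis :: "'e matroid \<Rightarrow> 'e set \<Rightarrow> bool" where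
  "basis M B \<longleftrightarrow> B \<in> indeps M \<and> (\<forall>I\<in>indeps M. B \<subseteq> I \<longrightarrow> I = B)"

definition circuit :: "'e matroid \<Rightarrow> 'e set \<Rightarrow> bool" where
  "circuit M C \<longleftrightarrow> C \<subseteq> ground M \<and> C \<notin> indeps M \<and> (\<forall>X. X \<subset> C \<longrightarrow> X \<in> indeps M)"

definition dual :: "'e matroid \<Rightarrow> 'e matroid" where
  "dual M = \<lparr>ground = ground M,
             indeps = {X. \<exists>B. basis M B \<and> X \<subseteq> ground M - B}\<rparr>"

definition cocircuit :: "'e matroid \<Rightarrow> 'e set \<Rightarrow> bool" where
  "cocircuit M C \<longleftrightarrow> circuit (dual M) C"

(* Only meaningful for X \<subseteq> ground M. *)
definition restriction :: "'e matroid \<Rightarrow> 'e set \<Rightarrow> 'e matroid" where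
  "restriction M X = \<lparr>ground = X, indeps = {I \<in> indeps M. I \<subseteq> X}\<rparr>"

definition restrictions :: "'e matroid \<Rightarrow> 'e matroid set" where
  "restrictions M = {restriction M X | X. X \<subseteq> ground M}"

(* A matrix with rows indexed by 'r and columns labelled by E is given by the function A
   that maps a label to its column; the (i,e) entry is A e $ i. Independence is that of
   the family of columns, whence the injectivity requirement. *)
definition vector_matroid :: "('e \<Rightarrow> 'k::field ^ 'r) \<Rightarrow> 'e set \<Rightarrow> 'e matroid" where
  "vector_matroid A E = \<lparr>ground = E,
     indeps = {X. X \<subseteq> E \<and> inj_on A X \<and> vec.independent (A ` X)}\<rparr>"

(* PG(r-1,2), where r = CARD('r) \<ge> 1. *)
definition PG :: "(bit ^ 'r) matroid" where
  "PG = vector_matroid (\<lambda>v. v) {v. v \<noteq> 0}"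

(* A is a matrix [I|D] representing M whose identity columns are labelled by B;
   b i is the element of B labelling the i-th identity column. *)
definition standard_representation ::
    "'e matroid \<Rightarrow> 'e set \<Rightarrow> ('e \<Rightarrow> 'k::field ^ 'r) \<Rightarrow> bool" where
  "standard_representation M B A \<longleftrightarrow>
     vector_matroid A (ground M) = M \<and>
     (\<exists>b. bij_betw b UNIV B \<and> (\<forall>i. A (b i) = axis i 1))"

definition row_cocircuit :: "'e matroid \<Rightarrow> ('e \<Rightarrow> 'k::field ^ 'r) \<Rightarrow> 'e set \<Rightarrow> bool" where
  "row_cocircuit M A C \<longleftrightarrow> cocircuit M C \<and> (\<exists>i. C = {e \<in> ground M. A e $ i \<noteq> 0})"

definition switching :: "(bit ^ 'r) set \<Rightarrow> (bit ^ 'r) matroid \<Rightarrow> (bit ^ 'r) matroid" where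
  "switching C M = restriction PG (sym_diff (ground M) C)"

lemma vector_matroid_is_matroid:
  fixes A :: "'e \<Rightarrow> 'k::field ^ 'r"
  assumes "finite E"
  shows "is_matroid (vector_matroid A E)"
proof -
  have aug: "\<exists>x\<in>J - I. insert x I \<subseteq> E \<and> inj_on A (insert x I) \<and> vec.independent (A ` insert x I)"
    if I: "I \<subseteq> E" "inj_on A I" "vec.independent (A ` I)"
      and J: "J \<subseteq> E" "inj_on A J" "vec.independent (A ` J)" and c: "card I < card J" for I J
  proof -
    have "\<not> A ` J \<subseteq> vec.span (A ` I)"
    proof
      assume "A ` J \<subseteq> vec.span (A ` I)"
      then have "card (A ` J) \<le> card (A ` I)"
        using vec.independent_span_bound[of "A ` I" "A ` J"] J(3) I(1) assms
        by (auto intro: finite_subset)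
      then show False
        using c card_image[OF I(2)] card_image[OF J(2)] by simp
    qed
    then obtain x where x: "x \<in> J" "A x \<notin> vec.span (A ` I)"
      by blast
    then have "A x \<notin> A ` I"
      using vec.span_base by blast
    moreover have "vec.independent (insert (A x) (A ` I))"
      using vec.independent_insertI[OF x(2) I(3)] .
    ultimately show ?thesis
      using x I J by (intro bexI[of _ x]) auto
  qed
  have her: "vec.independent (A ` J)" if "vec.independent (A ` I)" "J \<subseteq> I" for I J
    using vec.independent_mono[OF that(1) image_mono[OF that(2)]] .
  have "inj_on A J" if "inj_on A I" "J \<subseteq> I" for I J
    using inj_on_subset[OF that] .
  with her show ?thesis
    unfolding is_matroid_def vector_matroid_def
    using assms aug vec.independent_empty by (simp, blast)
qed

lemma is_matroid_PG: "is_matroid (PG :: (bit ^ 'r) matroid)"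
proof -
  have "(UNIV :: bit set) = {0, 1}"
    by (auto intro: bit.exhaust)
  then have "finite (UNIV :: bit set)"
    by (metis finite.emptyI finite.insertI)
  moreover have "inj (\<lambda>v :: bit ^ 'r. vec_nth v)"
    by (auto simp: inj_def vec_eq_iff)
  moreover have "finite (UNIV :: ('r \<Rightarrow> bit) set)"
    using calculation(1) finite_set_of_finite_funs[of "UNIV :: 'r set" "UNIV :: bit set"] by simp
  ultimately have "finite (UNIV :: (bit ^ 'r) set)"
    by (metis finite_imageD finite_subset subset_UNIV)
  then show ?thesis
    unfolding PG_def by (intro vector_matroid_is_matroid) (auto intro: finite_subset)
qed

end

(* The cocircuits of PG(r-1,2) are exactly the supports of the nonzero linear functionals on
   GF(2)^r. A matrix A representing PG(r-1,2) is, off 0, an additive bijection, so every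
   functional f is the sum of the rows of A indexed by S = {i. f (b i) = 1}, where b i labels
   the i-th identity column. The support of a sum over GF(2) is the symmetric difference of
   the supports, so switching by C is switching by the rows in S one after another. *)

theory Submission
  imports Defs
begin

section \<open>Linear algebra over GF(2)\<close>

lemma bit_vec_add_self: "v + v = (0 :: bit ^ 'n)"
  by (simp add: vec_eq_iff)

lemma bit_scale_cases: "c *s v = 0 \<or> c *s v = (v :: bit ^ 'n)"
  by (cases c) auto

lemma ex_bit: "(\<exists>c :: bit. P c) \<longleftrightarrow> P 0 \<or> P 1"
  by (metis bit.exhaust)

text \<open>The only scalars are 0 and 1, so an additive map is already linear; functionals are
  therefore handled as additive maps below.\<close>

lemma additive_eq_0_on_span:
  fixes f :: "bit ^ 'n \<Rightarrow> 'b::ab_group_add"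
  assumes f: "Modules.additive f" and S: "\<And>x. x \<in> S \<Longrightarrow> f x = 0" and x: "x \<in> vec.span S"
  shows "f x = 0"
  using x
proof (induction rule: vec.span_induct_alt)
  case base
  show ?case by (rule additive.zero[OF f])
next
  case (step c x y)
  then show ?case
    using S bit_scale_cases[of c x] by (auto simp: additive.add[OF f] additive.zero[OF f])
qed

section \<open>Bases and cocircuits of the projective geometry\<close>

lemma indeps_PG: "X \<in> indeps PG \<longleftrightarrow> vec.independent X"
  using vec.dependent_zero[of X] by (auto simp: PG_def vector_matroid_def)

lemma ground_PG [simp]: "ground PG = {v. v \<noteq> 0}"
  by (simp add: PG_def vector_matroid_def)

lemma basis_PG: "basis PG B \<longleftrightarrow> vec.independent B \<and> vec.span B = UNIV"
proof (intro iffI conjI)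
  assume B: "basis PG B"
  then show indep: "vec.independent B"
    by (simp add: basis_def indeps_PG)
  have "v \<in> vec.span B" for v
  proof (rule ccontr)
    assume v: "v \<notin> vec.span B"
    with indep have "insert v B \<in> indeps PG"
      by (simp add: indeps_PG vec.independent_insertI)
    then have "insert v B = B"
      using B unfolding basis_def by blast
    then have "v \<in> B"
      by blast
    with v show False
      by (simp add: vec.span_base)
  qed
  then show "vec.span B = UNIV"
    by blast
next
  assume B: "vec.independent B \<and> vec.span B = UNIV"
  have "I = B" if "vec.independent I" "B \<subseteq> I" for I
    using that B vec.spanning_subset_independent[of B I] by auto
  with B show "basis PG B"
    by (simp add: basis_def indeps_PG)
qed

text \<open>A set spans iff it contains a basis, so avoiding some basis means having a spanning
  complement. The complement \<open>- X\<close> also contains 0, which leaves its span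
  unchanged.\<close>

lemma indeps_dual_PG: "X \<in> indeps (dual PG) \<longleftrightarrow> 0 \<notin> X \<and> vec.span (- X) = UNIV"
proof
  assume "X \<in> indeps (dual PG)"
  then obtain B where B: "basis PG B" "X \<subseteq> {v. v \<noteq> 0} - B"
    by (auto simp: dual_def)
  then have "vec.span B \<subseteq> vec.span (- X)"
    by (intro vec.span_mono) auto
  with B show "0 \<notin> X \<and> vec.span (- X) = UNIV"
    by (auto simp: basis_PG)
next
  assume X: "0 \<notin> X \<and> vec.span (- X) = UNIV"
  obtain B where B: "B \<subseteq> - X" "vec.independent B" "- X \<subseteq> vec.span B"
    using vec.maximal_independent_subset by blast
  from B(3) have "vec.span (- X) \<subseteq> vec.span B"
    by (simp add: vec.span_minimal)
  with X B have "basis PG B" "X \<subseteq> {v. v \<noteq> 0} - B"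
    by (auto simp: basis_PG)
  then show "X \<in> indeps (dual PG)"
    by (auto simp: dual_def)
qed

lemma cocircuit_PG:
  "cocircuit PG C \<longleftrightarrow>
     0 \<notin> C \<and> vec.span (- C) \<noteq> UNIV \<and> (\<forall>X. X \<subset> C \<longrightarrow> vec.span (- X) = UNIV)"
  unfolding cocircuit_def circuit_def indeps_dual_PG by (auto simp: dual_def)

text \<open>The kernel of \<open>f\<close> is a proper subspace, and together with any single vector
  outside it, it spans everything: the complement of the support is a hyperplane.\<close>

lemma cocircuit_PG_support:
  fixes f :: "bit ^ 'n \<Rightarrow> bit"
  assumes f: "Modules.additive f" and nz: "f d \<noteq> 0"
  shows "cocircuit PG {v. f v \<noteq> 0}"
  unfolding cocircuit_PG
proof (intro conjI allI impI)
  show "0 \<notin> {v. f v \<noteq> 0}"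
    by (simp add: additive.zero[OF f])
  show "vec.span (- {v. f v \<noteq> 0}) \<noteq> UNIV"
    using additive_eq_0_on_span[OF f, of "- {v. f v \<noteq> 0}" d] nz by auto
next
  fix X assume "X \<subset> {v. f v \<noteq> 0}"
  then obtain e where e: "f e \<noteq> 0" "e \<notin> X"
    by blast
  have X: "v \<notin> X" if "f v = 0" for v
    using \<open>X \<subset> _\<close> that by blast
  have "v \<in> vec.span (- X)" for v
  proof (cases "f v = 0")
    case True
    then show ?thesis
      by (simp add: X vec.span_base)
  next
    case False
    \<comment> \<open>Both values are nonzero in GF(2), hence equal to 1.\<close>
    with e have "f (v - e) = 0"
      by (simp add: additive.diff[OF f])
    then have "v - e \<in> vec.span (- X)" "e \<in> vec.span (- X)"
      using X e by (simp_all add: vec.span_base)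
    then have "(v - e) + e \<in> vec.span (- X)"
      by (rule vec.span_add)
    then show ?thesis by simp
  qed
  then show "vec.span (- X) = UNIV"
    by blast
qed

lemma additive_separating_span:
  fixes S :: "(bit ^ 'n) set"
  assumes "vec.span S \<noteq> UNIV"
  obtains f :: "bit ^ 'n \<Rightarrow> bit" and d
  where "Modules.additive f" "\<forall>x\<in>S. f x = 0" "f d \<noteq> 0"
proof -
  obtain d where d: "d \<notin> vec.span S"
    using assms by blast
  obtain T where T: "T \<subseteq> S" "vec.independent T" "S \<subseteq> vec.span T"
    using vec.maximal_independent_subset by blast
  from T(1) d have dT: "d \<notin> vec.span T"
    using vec.span_mono by blast
  then have "d \<notin> T"
    using vec.span_base by blast
  have "vec.independent (insert d T)"
    using T dT by (simp add: vec.independent_insertI)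
  then obtain U where U: "insert d T \<subseteq> U" "vec.independent U" "vec.span U = UNIV"
    using vec.maximal_independent_subset_extend[OF subset_UNIV] by (metis top.extremum_uniqueI)
  \<comment> \<open>The coordinate at \<open>d\<close> in the basis \<open>U\<close>: it is 1 at
    \<open>d\<close> and 0 on the rest of \<open>U\<close>, in particular on \<open>T\<close>, which
    spans \<open>S\<close>.\<close>
  define f where "f v = vec.representation U v d" for v
  have f: "Modules.additive f"
    by (rule additive.intro) (simp add: f_def vec.representation_add U)
  have "f x = 0" if "x \<in> T" for x
    using that U \<open>d \<notin> T\<close> by (auto simp: f_def vec.representation_basis)
  with f T(3) have "f x = 0" if "x \<in> S" for x
    using that additive_eq_0_on_span[of f T x] by blast
  moreover have "f d \<noteq> 0"
    using U by (simp add: f_def vec.representation_basis)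
  ultimately show ?thesis
    using f that by blast
qed

text \<open>The complement of \<open>C\<close> does not span, so some nonzero functional vanishes on
  it. The support of this functional lies in \<open>C\<close> and also has a non-spanning
  complement, so minimality of \<open>C\<close> forces equality.\<close>

lemma cocircuit_PG_additive:
  fixes C :: "(bit ^ 'n) set"
  assumes C: "cocircuit PG C"
  obtains f :: "bit ^ 'n \<Rightarrow> bit" and d
  where "Modules.additive f" "f d \<noteq> 0" "C = {v. f v \<noteq> 0}"
proof -
  have "vec.span (- C) \<noteq> UNIV"
    using C by (simp add: cocircuit_PG)
  then obtain f :: "bit ^ 'n \<Rightarrow> bit" and d
    where f: "Modules.additive f" "\<forall>x\<in>- C. f x = 0" "f d \<noteq> 0"
    using additive_separating_span by blast
  have "vec.span (- {v. f v \<noteq> 0}) \<noteq> UNIV"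
    using cocircuit_PG_support[OF f(1,3)] by (simp add: cocircuit_PG)
  then have "\<not> {v. f v \<noteq> 0} \<subset> C"
    using C unfolding cocircuit_PG by blast
  with f(2) have "C = {v. f v \<noteq> 0}"
    by blast
  with f show ?thesis
    using that by blast
qed

section \<open>Matrices that represent the projective geometry\<close>

text \<open>
  The value \<open>A 0\<close> is unconstrained by a representation, hence the side conditions \<open>\<noteq> 0\<close>.
  Additivity comes from the circuits \<open>{u, v, u + v}\<close>.
\<close>

lemma PG_representation_additive:
  fixes A :: "bit ^ 'r \<Rightarrow> bit ^ 'r"
  assumes A: "vector_matroid A {v. v \<noteq> 0} = PG"
  shows PG_representation_nonzero: "v \<noteq> 0 \<Longrightarrow> A v \<noteq> 0"
    and "Modules.additive (\<lambda>v. if v = 0 then 0 else A v)"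
proof -
  have indep: "vec.independent X \<longleftrightarrow> 0 \<notin> X \<and> inj_on A X \<and> vec.independent (A ` X)" for X
    using indeps_PG[of X] unfolding A[symmetric] vector_matroid_def by auto
  show nz: "A v \<noteq> 0" if "v \<noteq> 0" for v
    using indep[of "{v}"] that by auto
  have mem: "x \<in> vec.span {u, v} \<longleftrightarrow> x = 0 \<or> x = u \<or> x = v \<or> x = u + v" for x u v :: "bit ^ 'r"
    by (auto simp: vec.span_breakdown_eq ex_bit diff_eq_eq add.commute)
  have mem1: "x \<in> vec.span {v} \<longleftrightarrow> x = 0 \<or> x = v" for x v :: "bit ^ 'r"
    using mem[of x v v] by (auto simp: bit_vec_add_self)
  have two: "vec.independent {u, v}" if "u \<noteq> 0" "v \<noteq> 0" "u \<noteq> v" for u v :: "bit ^ 'r"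
    using that by (simp add: vec.independent_insert mem1)
  have inj: "A u \<noteq> A v" if "u \<noteq> 0" "v \<noteq> 0" "u \<noteq> v" for u v
    using two[OF that] indep[of "{u, v}"] that by auto
  have add: "A (u + v) = A u + A v" if uv: "u \<noteq> 0" "v \<noteq> 0" "u \<noteq> v" for u v
  proof -
    have w: "u + v \<noteq> 0" "u + v \<noteq> u" "u + v \<noteq> v"
      using uv bit_vec_add_self[of v] by (auto simp: add_eq_0_iff2)
    have "\<not> vec.independent {u + v, u, v}"
      using mem[of "u + v" u v] w by (simp add: vec.independent_insert)
    \<comment> \<open>With the labels nonzero and the columns distinct, \<open>indep\<close> leaves
      linear dependence of the three columns as the only possibility.\<close>
    moreover have "inj_on A {u + v, u, v}"
      using inj uv w by (auto simp: inj_on_def)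
    ultimately have "\<not> vec.independent {A (u + v), A u, A v}"
      using indep[of "{u + v, u, v}"] uv w by auto
    moreover have "vec.independent {A u, A v}"
      using uv by (intro two nz inj)
    ultimately have "A (u + v) \<in> vec.span {A u, A v}"
      using vec.independent_insertI by blast
    \<comment> \<open>The span consists of 0, \<open>A u\<close>, \<open>A v\<close> and
      \<open>A u + A v\<close>; \<open>nz\<close> and \<open>inj\<close> exclude the first
      three.\<close>
    then show ?thesis
      using mem[of "A (u + v)" "A u" "A v"] nz inj uv w by auto
  qed
  show "Modules.additive (\<lambda>v. if v = 0 then 0 else A v)"
  proof (rule additive.intro)
    fix u v :: "bit ^ 'r"
    consider "u = 0" | "v = 0" | "u = v" | "u \<noteq> 0" "v \<noteq> 0" "u \<noteq> v" by blast
    then show "(if u + v = 0 then 0 else A (u + v)) = (if u = 0 then 0 else A u) + (if v = 0 then 0 else A v)"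
    proof cases
      case 4
      then have "u + v \<noteq> 0"
        using bit_vec_add_self[of v] by (metis add_right_cancel)
      with 4 show ?thesis by (simp add: add)
    qed (auto simp: bit_vec_add_self)
  qed
qed

section \<open>Composing switchings\<close>

lemma switching_restriction:
  "switching C (restriction PG X) = restriction PG (sym_diff X C)"
  by (simp add: switching_def restriction_def)

text \<open>A sum of two elements of GF(2) is nonzero iff exactly one of them is, so successive
  symmetric differences accumulate the support of the sum. \<open>X\<close> is arbitrary in the
  induction because each switching changes the ground set.\<close>

lemma fold_switching_supports:
  fixes g :: "'i \<Rightarrow> bit ^ 'r \<Rightarrow> bit"
  shows "fold switching (map (\<lambda>i. {v. v \<noteq> 0 \<and> g i v \<noteq> 0}) xs) (restriction PG X) =
         restriction PG (sym_diff X {v. v \<noteq> 0 \<and> (\<Sum>i\<leftarrow>xs. g i v) \<noteq> 0})"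
proof (induction xs arbitrary: X)
  case Nil
  then show ?case by simp
next
  case (Cons i xs)
  have "sym_diff (sym_diff X {v. v \<noteq> 0 \<and> g i v \<noteq> 0}) {v. v \<noteq> 0 \<and> (\<Sum>j\<leftarrow>xs. g j v) \<noteq> 0} =
        sym_diff X {v. v \<noteq> 0 \<and> (\<Sum>j\<leftarrow>i # xs. g j v) \<noteq> 0}"
    by auto
  then show ?case
    by (simp only: list.map fold_simps switching_restriction Cons.IH)
qed

theorem proposition4p3:
  fixes A :: "bit ^ 'r \<Rightarrow> bit ^ 'r" and B C :: "(bit ^ 'r) set"
  assumes "basis PG B"
    and "standard_representation PG B A"
    and "cocircuit PG C"
  shows "\<exists>Cs. Cs \<noteq> [] \<and> (\<forall>R\<in>set Cs. row_cocircuit PG A R) \<and>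
           (\<forall>M\<in>restrictions PG. switching C M = fold switching Cs M)"
proof -
  obtain b where rep: "vector_matroid A {v. v \<noteq> 0} = PG"
    and b: "range b = B" "\<And>i. A (b i) = axis i 1"
    using assms(2) by (auto simp: standard_representation_def bij_betw_def)
  \<comment> \<open>Resetting the value at 0 makes the matrix additive on the whole space and keeps
    its columns on the ground set.\<close>
  define L where "L v = (if v = 0 then 0 else A v)" for v
  have L: "Modules.additive L"
    unfolding L_def using PG_representation_additive(2)[OF rep] .
  have L_eq_0: "L v = 0 \<longleftrightarrow> v = 0" for v
    using PG_representation_nonzero[OF rep] by (simp add: L_def)
  have "0 \<notin> B"
    using assms(1) vec.dependent_zero by (auto simp: basis_PG)
  then have Lb: "L (b i) = axis i 1" for i
    using b by (auto simp: L_def)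
  have L_scale: "L (c *s v) = c *s L v" for c v
    by (cases c) (auto simp: additive.zero[OF L])
  \<comment> \<open>The column of \<open>v\<close> lists the coordinates of \<open>v\<close> in the
    basis \<open>B\<close>: both sides have the same image under \<open>L\<close>, whose kernel is
    trivial.\<close>
  have expand: "v = (\<Sum>i\<in>UNIV. L v $ i *s b i)" for v
  proof -
    have "L (v - (\<Sum>i\<in>UNIV. L v $ i *s b i)) = L v - (\<Sum>i\<in>UNIV. L v $ i *s axis i 1)"
      by (simp add: additive.diff[OF L] additive.sum[OF L] L_scale Lb)
    also have "\<dots> = 0"
      by (simp add: basis_expansion)
    finally show ?thesis
      by (simp add: L_eq_0)
  qed
  obtain f :: "bit ^ 'r \<Rightarrow> bit" and d where f: "Modules.additive f" "f d \<noteq> 0" "C = {v. f v \<noteq> 0}"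
    using cocircuit_PG_additive[OF assms(3)] by blast
  have f_scale: "f (c *s v) = c * f v" for c v
    by (cases c) (auto simp: additive.zero[OF f(1)])
  \<comment> \<open>These rows are the ones whose sum is \<open>f\<close>; distinctness turns the
    sum over the list into a sum over the set.\<close>
  obtain xs where xs: "set xs = {i. f (b i) \<noteq> 0}" "distinct xs"
    using finite_distinct_list[of "{i. f (b i) \<noteq> 0}"] by auto
  have f_eq: "f v = (\<Sum>i\<leftarrow>xs. L v $ i)" for v
  proof -
    have "f v = (\<Sum>i\<in>UNIV. L v $ i * f (b i))"
      by (subst expand[of v]) (simp only: additive.sum[OF f(1)] f_scale)
    also have "\<dots> = (\<Sum>i\<in>set xs. L v $ i)"
      unfolding xs by (rule sum.mono_neutral_cong_right) auto
    also have "\<dots> = (\<Sum>i\<leftarrow>xs. L v $ i)"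
      using xs(2) by (simp add: sum_list_distinct_conv_sum_set)
    finally show ?thesis .
  qed
  define Cs where "Cs = map (\<lambda>i. {v. v \<noteq> 0 \<and> L v $ i \<noteq> 0}) xs"
  have "row_cocircuit PG A {v. v \<noteq> 0 \<and> L v $ i \<noteq> 0}" for i
  proof -
    have "Modules.additive (\<lambda>v. L v $ i)"
      by (rule additive.intro) (simp add: additive.add[OF L])
    moreover have "L (b i) $ i \<noteq> 0"
      by (simp add: Lb)
    ultimately have "cocircuit PG {v. L v $ i \<noteq> 0}"
      by (rule cocircuit_PG_support)
    moreover have "{v. L v $ i \<noteq> 0} = {v. v \<noteq> 0 \<and> L v $ i \<noteq> 0}"
      by (auto simp: L_def)
    moreover have "{v. v \<noteq> 0 \<and> L v $ i \<noteq> 0} = {e \<in> ground PG. A e $ i \<noteq> 0}"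
      by (auto simp: L_def)
    ultimately show ?thesis
      unfolding row_cocircuit_def by (intro conjI exI[of _ i]) simp_all
  qed
  \<comment> \<open>An empty list of rows would have sum 0, contradicting
    \<open>f d \<noteq> 0\<close>.\<close>
  moreover have "Cs \<noteq> []"
    using f(2) f_eq[of d] by (auto simp: Cs_def)
  moreover have "switching C M = fold switching Cs M" if M: "M \<in> restrictions PG" for M
  proof -
    obtain X where X: "M = restriction PG X"
      using M by (auto simp: restrictions_def)
    have "C = {v. v \<noteq> 0 \<and> (\<Sum>i\<leftarrow>xs. L v $ i) \<noteq> 0}"
      using f(3) additive.zero[OF f(1)] by (auto simp flip: f_eq)
    then show ?thesis
      unfolding X Cs_def fold_switching_supports switching_restriction by simp
  qed
  ultimately show ?thesis
    by (intro exI[of _ Cs]) (auto simp: Cs_def)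
qed

end
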